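(* Let $\kappa>1$, $\delta>0$, and let $\Omega,\Omega^*\subset S^{n-1}$ be domains with $|\partial\Omega|=0$ and $x\cdot m\ge\frac1\kappa+\delta$ for all $x\in\Omega$, $m\in\Omega^*$. Let $m_1,\dots,m_N$ be distinct points in $\overline{\Omega^*}$, let $g_1,\dots,g_N$ be positive numbers, and let $f\in L^1(\Omega)$ be nonnegative, such that $x\cdot m_i\ge\frac1\kappa+\delta$ for $x\in\Omega$, $1\le i\le N$, and $$\int_{\overline\Omega}f(x)\,dx=\sum_{i=1}^Ng_i.$$ Then there exist positive numbers $b_1,b_2,\dots,b_N$ such that $\mathcal S=\{\rho(x)x:x\in\overline\Omega\}$ with $$\rho(x)=\max_{1\le i\le N}\frac{b_i}{\kappa\,m_i\cdot x-1}$$ is a weak solution to the far field refractor problem for $\kappa>1$ with emitting intensity $f$ and prescribed refracted intensity $\mu=\sum_{i=1}^Ng_i\delta_{m_i}$. Moreover, $\mathcal M_{\mathcal S,f}(\{m_i\})=g_i$ for $1\le i\le N$.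
   Context: $S^{n-1}$ is the unit sphere in $\mathbb R^n$ ($n\ge2$); $|\cdot|$ of subsets of the sphere and $dx$ refer to surface measure on the sphere. For $m\in\overline{\Omega^*}$, $b>0$, let $\rho(x,m,b)=\dfrac{b}{\kappa\,m\cdot x-1}$ (a semi-hyperboloid). A surface $\mathcal S=\{\rho(x)x:x\in\overline\Omega\}$ with $\rho>0$ continuous on $\overline\Omega$ is a far field refractor (for $\kappa>1$) if for each $x_0\in\overline\Omega$ there exist $m\in\overline{\Omega^*}$ and $b>0$ such that the semi-hyperboloid $\rho(\cdot,m,b)$ supports $\mathcal S$ at $\rho(x_0)x_0$, i.e. $\rho(x)\ge\rho(x,m,b)$ for all $x\in\overline\Omega$ with equality at $x=x_0$. The far field refractor mapping is $$\mathcal N_{\mathcal S}(x_0)=\{m\in\overline{\Omega^*}:\rho(\cdot,m,b)\text{ supports }\mathcal S\text{ at }\rho(x_0)x_0\text{ for some }b>0\}.$$ For $F\subset\overline{\Omega^*}$, $\mathcal N_{\mathcal S}^{-1}(F)=\{x\in\overline\Omega:\mathcal N_{\mathcal S}(x)\cap F\ne\emptyset\}$ and $\mathcal M_{\mathcal S,f}(F)=\int_{\mathcal N_{\mathcal S}^{-1}(F)}f\,dx$, a Radon measure on $\overline{\Omega^*}$. A far field refractor $\mathcal S$ is a weak solution of the far field refractor problem with emitting intensity $f$ and prescribed refracted intensity $\mu$ on $\overline{\Omega^*}$ if $\mathcal M_{\mathcal S,f}(F)=\mu(F)$ for every Borel set $F\subset\overline{\Omega^*}$. *)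

theory Defs
  imports "HOL-Analysis.Analysis" "HOL-Probability.Giry_Monad"
begin

text \<open>
  Surface measure on the unit sphere of an \<open>n\<close>-dimensional Euclidean space, obtained from polar
  coordinates: \<open>\<bar>A\<bar> = n \<cdot> vol {r x. 0 < r < 1, x \<in> A}\<close>. The radial projection of the punctured
  open unit ball is \<^const>\<open>sgn\<close>. The measure is completed, so that every subset of a null
  set is measurable.
\<close>

definition surface_measure :: "'a::euclidean_space measure" where
  "surface_measure =
     completion (scale_measure (of_nat DIM('a))
       (distr (restrict_space lborel (ball 0 1 - {0})) (restrict_space borel (sphere 0 1)) sgn))"

definition spherical_domain :: "'a::euclidean_space set \<Rightarrow> bool" where
  "spherical_domain \<Omega> \<longleftrightarrow>
     openin (top_of_set (sphere 0 1)) \<Omega> \<and> connected \<Omega> \<and> \<Omega> \<noteq> {}"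

definition semi_hyperboloid :: "real \<Rightarrow> 'a::euclidean_space \<Rightarrow> real \<Rightarrow> 'a \<Rightarrow> real" where
  "semi_hyperboloid \<kappa> m b x = b / (\<kappa> * (m \<bullet> x) - 1)"

text \<open>
  A surface \<open>{\<rho>(x) x. x \<in> closure \<Omega>}\<close> is represented by its radial function \<open>\<rho>\<close>; only the values of
  \<open>\<rho>\<close> on \<open>closure \<Omega>\<close> matter below. For a subset of the sphere, the closure in the sphere and the
  closure in the ambient space coincide.
\<close>

definition supports_at ::
    "real \<Rightarrow> 'a::euclidean_space set \<Rightarrow> ('a \<Rightarrow> real) \<Rightarrow> 'a \<Rightarrow> real \<Rightarrow> 'a \<Rightarrow> bool" where
  "supports_at \<kappa> \<Omega> \<rho> m b x0 \<longleftrightarrow>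
     (\<forall>x\<in>closure \<Omega>. semi_hyperboloid \<kappa> m b x \<le> \<rho> x) \<and> \<rho> x0 = semi_hyperboloid \<kappa> m b x0"

definition far_field_refractor ::
    "real \<Rightarrow> 'a::euclidean_space set \<Rightarrow> 'a set \<Rightarrow> ('a \<Rightarrow> real) \<Rightarrow> bool" where
  "far_field_refractor \<kappa> \<Omega> \<Omega>s \<rho> \<longleftrightarrow>
     continuous_on (closure \<Omega>) \<rho> \<and> (\<forall>x\<in>closure \<Omega>. 0 < \<rho> x) \<and>
     (\<forall>x0\<in>closure \<Omega>. \<exists>m\<in>closure \<Omega>s. \<exists>b>0. supports_at \<kappa> \<Omega> \<rho> m b x0)"

definition refractor_mapping ::
    "real \<Rightarrow> 'a::euclidean_space set \<Rightarrow> 'a set \<Rightarrow> ('a \<Rightarrow> real) \<Rightarrow> 'a \<Rightarrow> 'a set" where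
  "refractor_mapping \<kappa> \<Omega> \<Omega>s \<rho> x0 = {m \<in> closure \<Omega>s. \<exists>b>0. supports_at \<kappa> \<Omega> \<rho> m b x0}"

definition refractor_preimage ::
    "real \<Rightarrow> 'a::euclidean_space set \<Rightarrow> 'a set \<Rightarrow> ('a \<Rightarrow> real) \<Rightarrow> 'a set \<Rightarrow> 'a set" where
  "refractor_preimage \<kappa> \<Omega> \<Omega>s \<rho> F =
     {x \<in> closure \<Omega>. refractor_mapping \<kappa> \<Omega> \<Omega>s \<rho> x \<inter> F \<noteq> {}}"

text \<open>The intensity \<open>f\<close> is meant to be nonnegative almost everywhere; \<^const>\<open>ennreal\<close>
  truncates negative values to 0.\<close>

definition refractor_measure ::
    "real \<Rightarrow> 'a::euclidean_space set \<Rightarrow> 'a set \<Rightarrow> ('a \<Rightarrow> real) \<Rightarrow> ('a \<Rightarrow> real) \<Rightarrow> 'a set \<Rightarrow> ennreal" where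
  "refractor_measure \<kappa> \<Omega> \<Omega>s \<rho> f F =
     (\<integral>\<^sup>+x\<in>refractor_preimage \<kappa> \<Omega> \<Omega>s \<rho> F. ennreal (f x) \<partial>surface_measure)"

text \<open>The measurability clause is what makes the integral over the preimage meaningful.\<close>

definition weak_solution ::
    "real \<Rightarrow> 'a::euclidean_space set \<Rightarrow> 'a set \<Rightarrow> ('a \<Rightarrow> real) \<Rightarrow> 'a measure \<Rightarrow> ('a \<Rightarrow> real) \<Rightarrow> bool" where
  "weak_solution \<kappa> \<Omega> \<Omega>s f \<mu> \<rho> \<longleftrightarrow>
     far_field_refractor \<kappa> \<Omega> \<Omega>s \<rho> \<and>
     (\<forall>F\<in>sets (restrict_space borel (closure \<Omega>s)).
        refractor_preimage \<kappa> \<Omega> \<Omega>s \<rho> F \<in> sets surface_measure \<and>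
        refractor_measure \<kappa> \<Omega> \<Omega>s \<rho> f F = emeasure \<mu> F)"

text \<open>The Borel measure \<open>\<Sum>i\<in>I. g i \<delta>\<close> on \<open>C\<close>, with the Dirac mass of index \<open>i\<close> placed at \<open>p i\<close>.\<close>

definition dirac_sum ::
    "'a::topological_space set \<Rightarrow> 'i set \<Rightarrow> ('i \<Rightarrow> real) \<Rightarrow> ('i \<Rightarrow> 'a) \<Rightarrow> 'a measure" where
  "dirac_sum C I g p =
     measure_of C (sets (restrict_space borel C))
       (\<lambda>F. \<Sum>i\<in>I. ennreal (g i) * emeasure (return (restrict_space borel C) (p i)) F)"

lemma measurable_sgn_sphere:
  "sgn \<in> restrict_space lborel (ball 0 1 - {0})
     \<rightarrow>\<^sub>M restrict_space borel (sphere 0 (1::real) :: 'a::euclidean_space set)"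
proof (rule measurable_restrict_space2)
  show "sgn \<in> space (restrict_space lborel (ball 0 1 - {0})) \<rightarrow> sphere (0::'a) 1"
    by (auto simp: space_restrict_space norm_sgn)
  have "(sgn :: 'a \<Rightarrow> 'a) \<in> borel_measurable borel"
    unfolding sgn_div_norm by measurable
  then show "(sgn :: 'a \<Rightarrow> 'a) \<in> restrict_space lborel (ball 0 1 - {0}) \<rightarrow>\<^sub>M borel"
    by (intro measurable_restrict_space1) simp
qed

lemma space_surface_measure [simp]: "space surface_measure = sphere 0 1"
  by (simp add: surface_measure_def space_scale_measure space_restrict_space)

lemma emeasure_surface_measure:
  fixes A :: "'a::euclidean_space set"
  assumes "A \<in> sets borel" "A \<subseteq> sphere 0 1"
  shows "emeasure surface_measure A =
    of_nat DIM('a) * emeasure lborel {r *\<^sub>R x | r x. 0 < r \<and> r < 1 \<and> x \<in> A}"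
proof -
  have A: "A \<in> sets (restrict_space borel (sphere 0 1))"
    using assms by (auto simp: sets_restrict_space_iff)
  have eq: "sgn -` A \<inter> (ball 0 1 - {0}) = {r *\<^sub>R x | r x. 0 < r \<and> r < 1 \<and> x \<in> A}"
    (is "?L = ?R")
  proof (intro subset_antisym subsetI)
    fix y assume y: "y \<in> ?L"
    have "y = norm y *\<^sub>R sgn y" by (cases "y = 0") (simp_all add: sgn_div_norm)
    then show "y \<in> ?R" using y by fastforce
  next
    fix y assume "y \<in> ?R"
    then obtain r x where y: "y = r *\<^sub>R x" "0 < r" "r < 1" "x \<in> A" by auto
    moreover have "norm x = 1" using y assms by auto
    ultimately show "y \<in> ?L" by (auto simp: sgn_div_norm)
  qed
  show ?thesis
    unfolding surface_measure_def using A
    by (simp add: emeasure_completion emeasure_scale_measure emeasure_distr[OF measurable_sgn_sphere]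
        main_part_sets space_restrict_space eq emeasure_restrict_space[of "ball 0 1 - {0}"]
        flip: eq)
qed

lemma sets_dirac_sum [simp]: "sets (dirac_sum C I g p) = sets (restrict_space borel C)"
  by (simp add: dirac_sum_def sets.sigma_sets_eq[of "restrict_space borel C",
        simplified space_restrict_space, simplified] sets.space_closed[of "restrict_space borel C",
        simplified space_restrict_space, simplified])

lemma emeasure_dirac_sum:
  assumes "F \<in> sets (restrict_space borel C)"
  shows "emeasure (dirac_sum C I g p) F = (\<Sum>i\<in>I. ennreal (g i) * indicator F (p i))"
proof -
  have "emeasure (dirac_sum C I g p) F =
      (\<Sum>i\<in>I. ennreal (g i) * emeasure (return (restrict_space borel C) (p i)) F)"
    unfolding dirac_sum_def
  proof (rule emeasure_measure_of_sigma)
    let ?M = "restrict_space borel C"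
    show "sigma_algebra C (sets ?M)"
      using sets.sigma_algebra_axioms[of ?M] by (simp add: space_restrict_space)
    show "positive (sets ?M) (\<lambda>F. \<Sum>i\<in>I. ennreal (g i) * emeasure (return ?M (p i)) F)"
      by (simp add: positive_def)
    show "countably_additive (sets ?M) (\<lambda>F. \<Sum>i\<in>I. ennreal (g i) * emeasure (return ?M (p i)) F)"
    proof (rule countably_additiveI)
      fix A :: "nat \<Rightarrow> 'a set"
      assume A: "range A \<subseteq> sets ?M" "disjoint_family A"
      have "(\<Sum>n. \<Sum>i\<in>I. ennreal (g i) * emeasure (return ?M (p i)) (A n)) =
          (\<Sum>i\<in>I. \<Sum>n. ennreal (g i) * emeasure (return ?M (p i)) (A n))"
        by (rule suminf_sum) simp
      also have "\<dots> = (\<Sum>i\<in>I. ennreal (g i) * emeasure (return ?M (p i)) (\<Union> (range A)))"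
        using A by (simp add: suminf_emeasure del: emeasure_return)
      finally show "(\<Sum>n. \<Sum>i\<in>I. ennreal (g i) * emeasure (return ?M (p i)) (A n)) =
          (\<Sum>i\<in>I. ennreal (g i) * emeasure (return ?M (p i)) (\<Union> (range A)))" .
    qed
  qed (use assms in auto)
  then show ?thesis
    using assms by simp
qed

end

theory Submission
  imports Defs
begin

text \<open>
  Write \<open>h i x = 1 / (\<kappa> * (m i \<bullet> x) - 1)\<close>, a positive continuous function on \<open>closure \<Omega>\<close>. For
  weights \<open>b\<close>, the refractor \<open>\<rho> = max b i * h i\<close> divides \<open>closure \<Omega>\<close> into the cells where
  \<open>b i * h i\<close> realises the maximum. The theorem rests on two facts.

  Geometry: the directions where two semi-hyperboloids with different axes agree satisfy a linear
  equation \<open>a \<bullet> x = c\<close>, and \<open>\<kappa> > 1\<close> forces \<open>\<bar>c\<bar> < norm a\<close>. So the hyperplane cuts the sphere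
  transversally. This makes ties a null set (\<open>AE_semi_hyperboloid_no_tie\<close>), and it prevents a
  semi-hyperboloid from touching another one from below at an interior point unless the axes agree
  (\<open>semi_hyperboloids_touching_eq\<close>). Hence at almost every \<open>x\<close> the refractor mapping is exactly
  \<open>{m i}\<close>, where \<open>i\<close> is the index of the cell of \<open>x\<close> (\<open>refractor_mapping_MAX\<close>); the refractor
  measure is therefore concentrated on the \<open>m i\<close>, and \<open>m i\<close> receives the \<open>f\<close>-mass of cell \<open>i\<close>.

  Balancing the masses: it remains to choose the weights so that cell \<open>i\<close> has mass \<open>g i\<close>. The
  argument uses three properties: raising a weight enlarges its own cell and shrinks all others, the masses
  depend continuously on the weights because ties are null, and the cells cover the space. A
  Perron-type argument then works for any finite measure
  (\<open>exists_weights_with_cell_measures\<close>): fix one weight to be 1 and take the largest weights for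
  which no other cell exceeds its prescribed mass.
\<close>

section \<open>Balancing the cells of a weighted maximum\<close>

text \<open>
  A weight may vanish: its cell is then empty as soon as some other weight is positive, so ties
  matter between positive weights only. Admitting zero weights keeps the set of weights closed under
  limits in the balancing argument.
\<close>

locale weighted_cells = finite_measure M for M :: "'a measure" +
  fixes I :: "'i set" and h :: "'i \<Rightarrow> 'a \<Rightarrow> real"
  assumes finite_index: "finite I"
    and measurable_h [measurable]: "\<And>i. i \<in> I \<Longrightarrow> h i \<in> borel_measurable M"
    and h_pos: "\<And>i x. i \<in> I \<Longrightarrow> x \<in> space M \<Longrightarrow> 0 < h i x"
    and AE_no_tie: "\<And>i j s t. i \<in> I \<Longrightarrow> j \<in> I \<Longrightarrow> i \<noteq> j \<Longrightarrow> 0 < s \<Longrightarrow> 0 < t \<Longrightarrow>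
      AE x in M. s * h i x \<noteq> t * h j x"
begin

definition cell :: "('i \<Rightarrow> real) \<Rightarrow> 'i \<Rightarrow> 'a set" where
  "cell b i = {x \<in> space M. \<forall>j\<in>I. b j * h j x \<le> b i * h i x}"

lemma sets_cell [measurable]: "i \<in> I \<Longrightarrow> cell b i \<in> sets M"
  unfolding cell_def using finite_index by measurable

text \<open>
  This monotonicity drives the balancing argument: the cell of \<open>i\<close> for a coordinatewise maximum of
  weights lies in the cell of \<open>i\<close> for whichever of them attains the maximum at \<open>i\<close>.
\<close>

lemma cell_antimono:
  assumes "i \<in> I" "c i \<le> b i" "\<And>j. j \<in> I \<Longrightarrow> b j \<le> c j"
  shows "cell c i \<subseteq> cell b i"
proof
  fix x assume x: "x \<in> cell c i"
  then have "x \<in> space M" by (simp add: cell_def)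
  have "b j * h j x \<le> b i * h i x" if "j \<in> I" for j
  proof -
    have "b j * h j x \<le> c j * h j x"
      using assms(3) h_pos[OF that \<open>x \<in> space M\<close>] that by (intro mult_right_mono) auto
    also have "\<dots> \<le> c i * h i x" using x that by (simp add: cell_def)
    also have "\<dots> \<le> b i * h i x"
      using assms(1,2) h_pos[OF assms(1) \<open>x \<in> space M\<close>] by (intro mult_right_mono) auto
    finally show ?thesis .
  qed
  then show "x \<in> cell b i" using \<open>x \<in> space M\<close> by (simp add: cell_def)
qed

lemma cell_eq_empty:
  assumes "i \<in> I" "b i = 0" "j \<in> I" "0 < b j"
  shows "cell b i = {}"
  using assms h_pos[OF \<open>j \<in> I\<close>] by (force simp: cell_def mult_le_0_iff)

text \<open>
  Inside a cell, a competitor with positive weight is beaten strictly outside the null set of ties,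
  and one with zero weight is always beaten strictly. Some weight has to be positive, for if all
  weights are zero, then all cells are the whole space.
\<close>

lemma AE_cell_strict:
  assumes b: "\<forall>i\<in>I. 0 \<le> b i" and k: "k \<in> I" "0 < b k"
  shows "AE x in M. \<forall>i\<in>I. x \<in> cell b i \<longrightarrow> (\<forall>j\<in>I - {i}. b j * h j x < b i * h i x)"
proof -
  have "AE x in M. \<forall>i\<in>I. \<forall>j\<in>I - {i}. 0 < b i \<longrightarrow> 0 < b j \<longrightarrow> b i * h i x \<noteq> b j * h j x"
    using finite_index AE_no_tie by (intro AE_finite_allI) (auto simp: eq_commute)
  then show ?thesis
  proof (eventually_elim, intro ballI impI)
    fix x i j
    assume tie: "\<forall>i\<in>I. \<forall>j\<in>I - {i}. 0 < b i \<longrightarrow> 0 < b j \<longrightarrow> b i * h i x \<noteq> b j * h j x"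
      and i: "i \<in> I" and x: "x \<in> cell b i" and j: "j \<in> I - {i}"
    have x': "x \<in> space M" using x by (simp add: cell_def)
    have "0 < b i" using cell_eq_empty[where b=b, OF i _ k] x b i by force
    have "b j * h j x \<le> b i * h i x" using x j by (auto simp: cell_def)
    moreover have "b j * h j x \<noteq> b i * h i x"
      using tie i j \<open>0 < b i\<close> h_pos[OF i x'] b by (cases "b j = 0") force+
    ultimately show "b j * h j x < b i * h i x" by simp
  qed
qed

text \<open>The cells overlap only in ties, so their masses add up.\<close>

lemma measure_UN_cell:
  assumes b: "\<forall>i\<in>I. 0 \<le> b i" and k: "k \<in> I" "0 < b k" and J: "J \<subseteq> I"
  shows "measure M (\<Union>i\<in>J. cell b i) = (\<Sum>i\<in>J. measure M (cell b i))"
proof (rule measure_UNION_AE)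
  show "finite J" using J finite_index finite_subset by blast
  show "cell b i \<in> fmeasurable M" if "i \<in> J" for i
    using that J sets_cell by (auto simp: fmeasurable_eq_sets)
  show "pairwise (\<lambda>i j. AE x in M. x \<notin> cell b i \<or> x \<notin> cell b j) J"
  proof (rule pairwiseI)
    fix i j assume ij: "i \<in> J" "j \<in> J" "i \<noteq> j"
    from AE_cell_strict[OF b k] show "AE x in M. x \<notin> cell b i \<or> x \<notin> cell b j"
    proof eventually_elim
      case (elim x)
      have "b j * h j x < b i * h i x" if "x \<in> cell b i" using elim that ij J by blast
      moreover have "b i * h i x < b j * h j x" if "x \<in> cell b j" using elim that ij J by blast
      ultimately show ?case by fastforce
    qed
  qed
qed

lemma UN_cell:
  assumes "I \<noteq> {}"
  shows "(\<Union>i\<in>I. cell b i) = space M"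
proof (intro subset_antisym subsetI)
  fix x assume x: "x \<in> space M"
  let ?V = "(\<lambda>j. b j * h j x) ` I"
  have "Max ?V \<in> ?V" using assms finite_index by (intro Max_in) auto
  then obtain i where i: "i \<in> I" "Max ?V = b i * h i x" by auto
  have "b j * h j x \<le> b i * h i x" if "j \<in> I" for j
    using that finite_index unfolding i(2)[symmetric] by (intro Max_ge) auto
  then show "x \<in> (\<Union>i\<in>I. cell b i)" using x i by (auto simp: cell_def)
qed (auto simp: cell_def)

text \<open>
  Away from ties, the strict inequalities that decide whether \<open>x\<close> belongs to the cell persist under
  small changes of the weights. So the indicator functions of the cells converge almost everywhere,
  and dominated convergence applies.
\<close>

lemma tendsto_measure_cell:
  assumes b: "\<forall>i\<in>I. 0 \<le> b i" and k: "k \<in> I" "0 < b k"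
    and B: "\<And>j. j \<in> I \<Longrightarrow> (\<lambda>n. B n j) \<longlonglongrightarrow> b j" and i: "i \<in> I"
  shows "(\<lambda>n. measure M (cell (B n) i)) \<longlonglongrightarrow> measure M (cell b i)"
proof -
  let ?ind = "\<lambda>b x. indicator (cell b i) x :: real"
  have lim: "(\<lambda>n. B n j * h j x) \<longlonglongrightarrow> b j * h j x" if "j \<in> I" for j x
    using B[OF that] by (intro tendsto_intros)
  have ev: "\<forall>\<^sub>F n in sequentially. B n j * h j x < B n l * h l x"
    if "j \<in> I" "l \<in> I" "b j * h j x < b l * h l x" for j l x
    using order_tendstoD(1)[OF tendsto_diff[OF lim[of l x] lim[of j x]], of 0] that by simp
  have "(\<lambda>n. LINT x|M. ?ind (B n) x) \<longlonglongrightarrow> (LINT x|M. ?ind b x)"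
  proof (rule integral_dominated_convergence[where w = "\<lambda>_. 1"])
    show "AE x in M. (\<lambda>n. ?ind (B n) x) \<longlonglongrightarrow> ?ind b x"
      using AE_cell_strict[OF b k] AE_space
    proof eventually_elim
      case (elim x)
      have "\<forall>\<^sub>F n in sequentially. (x \<in> cell (B n) i) = (x \<in> cell b i)"
      proof (cases "x \<in> cell b i")
        case True
        have "\<forall>\<^sub>F n in sequentially. \<forall>j\<in>I - {i}. B n j * h j x < B n i * h i x"
          using finite_index elim True i by (intro eventually_ball_finite ballI ev) auto
        then show ?thesis
        proof eventually_elim
          case (elim n)
          then have "B n j * h j x \<le> B n i * h i x" if "j \<in> I" for j
            using that by (cases "j = i") (auto intro: less_imp_le)
          with True show ?case by (simp add: cell_def)
        qed
      next
        case False
        then obtain j where j: "j \<in> I" "b i * h i x < b j * h j x"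
          using elim by (auto simp: cell_def not_le)
        have "\<forall>\<^sub>F n in sequentially. B n i * h i x < B n j * h j x"
          using i j by (intro ev)
        then show ?thesis
          by eventually_elim (use False j in \<open>auto simp: cell_def not_le\<close>)
      qed
      then have "\<forall>\<^sub>F n in sequentially. ?ind (B n) x = ?ind b x"
        by eventually_elim (simp add: indicator_def)
      then show ?case by (rule tendsto_eventually)
    qed
  qed (use i in \<open>auto simp: indicator_def\<close>)
  moreover have "(LINT x|M. ?ind c x) = measure M (cell c i)" for c
    using i sets_cell[OF i, of c] by (simp add: emeasure_eq_measure)
  ultimately show ?thesis by simp
qed

text \<open>
  Let \<open>W\<close> be the set of weights with \<open>b i0 = 1\<close> for which every other cell has at most its prescribed
  mass. The cell of \<open>i0\<close> then keeps at least the mass \<open>g i0 > 0\<close>, and this bounds each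
  coordinate on \<open>W\<close>. By \<open>cell_antimono\<close>, \<open>W\<close> is closed under coordinatewise maxima, so by
  continuity it contains its coordinatewise supremum \<open>s\<close>. If a cell \<open>i \<noteq> i0\<close> had mass below \<open>g i\<close>
  at \<open>s\<close>, then \<open>s i\<close> could be raised slightly within \<open>W\<close>, as this only shrinks the other cells. The
  mass of the cell of \<open>i0\<close> is then right because the totals agree, and no weight vanishes because
  no cell is null.
\<close>

theorem exists_weights_with_cell_measures:
  assumes "I \<noteq> {}" and g: "\<forall>i\<in>I. 0 < g i"
    and total: "measure M (space M) = (\<Sum>i\<in>I. g i)"
  shows "\<exists>b. \<forall>i\<in>I. 0 < b i \<and> measure M (cell b i) = g i"
proof -
  obtain i0 where i0: "i0 \<in> I" using \<open>I \<noteq> {}\<close> by blast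
  define W where "W = {b. b i0 = 1 \<and> (\<forall>i\<in>I. 0 \<le> b i) \<and>
    (\<forall>i\<in>I - {i0}. measure M (cell b i) \<le> g i)}"
  have W_nonneg: "\<forall>i\<in>I. 0 \<le> b i" if "b \<in> W" for b using that by (auto simp: W_def)
  have W_i0: "0 < b i0" if "b \<in> W" for b using that by (auto simp: W_def)
  have cells_total: "measure M (cell b i0) + (\<Sum>i\<in>I - {i0}. measure M (cell b i)) = (\<Sum>i\<in>I. g i)"
    if "b \<in> W" for b
  proof -
    have "(\<Sum>i\<in>I. measure M (cell b i)) = (\<Sum>i\<in>I. g i)"
      using measure_UN_cell[OF W_nonneg[OF that] i0 W_i0[OF that] order_refl]
        UN_cell[OF \<open>I \<noteq> {}\<close>, of b]
      by (simp add: total)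
    then show ?thesis using finite_index i0 by (simp add: sum.remove)
  qed
  have W_ge: "g i0 \<le> measure M (cell b i0)" if "b \<in> W" for b
  proof -
    have "(\<Sum>i\<in>I - {i0}. measure M (cell b i)) \<le> (\<Sum>i\<in>I - {i0}. g i)"
      using that by (intro sum_mono) (auto simp: W_def)
    with cells_total[OF that] show ?thesis using finite_index i0 by (simp add: sum.remove)
  qed

  \<comment> \<open>With all weights but one equal to zero, the other cells are empty; so \<open>W\<close> is inhabited.\<close>
  let ?e = "\<lambda>i. if i = i0 then 1 else 0 :: real"
  have "measure M (cell ?e i) \<le> g i" if "i \<in> I - {i0}" for i
    using cell_eq_empty[where b="?e" and i=i and j=i0] that i0 g by (simp add: less_imp_le)
  then have "?e \<in> W" by (simp add: W_def)

  \<comment> \<open>If \<open>b i > n\<close>, then the cell of \<open>i0\<close> lies in the set where \<open>n * h i \<le> h i0\<close>; these sets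
    decrease to the empty set, so they cannot all carry the mass \<open>g i0\<close>.\<close>
  have bdd: "bdd_above ((\<lambda>b. b i) ` W)" if i: "i \<in> I" for i
  proof (rule ccontr)
    assume unbdd: "\<not> bdd_above ((\<lambda>b. b i) ` W)"
    let ?D = "\<lambda>n::nat. {x \<in> space M. real n * h i x \<le> h i0 x}"
    have "g i0 \<le> measure M (?D n)" for n
    proof -
      from unbdd obtain b where b: "b \<in> W" "real n < b i"
        unfolding bdd_above_def by (auto simp: not_le)
      have "cell b i0 \<subseteq> ?D n"
      proof
        fix x assume x: "x \<in> cell b i0"
        then have x': "x \<in> space M" by (simp add: cell_def)
        have "real n * h i x \<le> b i * h i x"
          using b h_pos[OF i x'] by (intro mult_right_mono) auto
        also have "\<dots> \<le> h i0 x" using x b i by (auto simp: cell_def W_def)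
        finally show "x \<in> ?D n" using x' by simp
      qed
      then have "measure M (cell b i0) \<le> measure M (?D n)"
        using i i0 by (intro finite_measure_mono) measurable
      with W_ge[OF b(1)] show ?thesis by simp
    qed
    moreover have "(\<lambda>n. measure M (?D n)) \<longlonglongrightarrow> measure M (\<Inter>n. ?D n)"
    proof (rule finite_Lim_measure_decseq)
      show "range ?D \<subseteq> sets M" using i i0 by auto
      show "decseq ?D"
      proof (intro decseq_SucI subsetI)
        fix n x assume x: "x \<in> ?D (Suc n)"
        then have "real n * h i x \<le> real (Suc n) * h i x"
          using h_pos[OF i, of x] by (intro mult_right_mono) auto
        then show "x \<in> ?D n" using x by auto
      qed
    qed
    moreover have "(\<Inter>n. ?D n) = {}"
    proof -
      have "\<exists>n. h i0 x < real n * h i x" if "x \<in> space M" for x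
        using reals_Archimedean3[OF h_pos[OF i that]] by auto
      then show ?thesis by (auto simp: set_eq_iff not_le)
    qed
    ultimately have "g i0 \<le> 0" by (auto intro: LIMSEQ_le_const)
    with g i0 show False by force
  qed

  define s where "s i = (SUP b\<in>W. b i)" for i
  have s_upper: "b i \<le> s i" if "b \<in> W" "i \<in> I" for b i
    unfolding s_def using bdd that by (intro cSUP_upper)
  have "\<exists>b\<in>W. s i - 1 / Suc n < b i" if "i \<in> I" for i and n :: nat
    using less_cSUP_iff[of W "\<lambda>b. b i" "s i - 1 / Suc n"] bdd[OF that] \<open>?e \<in> W\<close>
    by (auto simp: s_def)
  \<comment> \<open>\<open>B i n\<close> nearly attains the supremum in coordinate \<open>i\<close>; the maximum \<open>C n\<close> of these finitely many
    weights nearly attains it in all coordinates at once and still lies in \<open>W\<close>.\<close>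
  then obtain B where B: "\<And>i n. i \<in> I \<Longrightarrow> B i n \<in> W \<and> s i - 1 / Suc n < B i n i"
    by metis
  define C where "C n j = Max ((\<lambda>i. B i n j) ` I)" for n j
  have C_ge: "B i n j \<le> C n j" if "i \<in> I" for i n j
    unfolding C_def using that finite_index by (intro Max_ge) auto
  have C_attained: "\<exists>i\<in>I. C n j = B i n j" for n j
  proof -
    have "C n j \<in> (\<lambda>i. B i n j) ` I"
      unfolding C_def using \<open>I \<noteq> {}\<close> finite_index by (intro Max_in) auto
    then show ?thesis by auto
  qed
  have C_W: "C n \<in> W" for n
    unfolding W_def
  proof (intro CollectI conjI ballI)
    show "C n i0 = 1" using C_attained[of n i0] B by (auto simp: W_def)
    show "0 \<le> C n i" if "i \<in> I" for i using C_attained[of n i] B that by (auto simp: W_def)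
    fix i assume i: "i \<in> I - {i0}"
    obtain k where k: "k \<in> I" "C n i = B k n i" using C_attained by blast
    have "measure M (cell (C n) i) \<le> measure M (cell (B k n) i)"
      using i k C_ge by (intro finite_measure_mono cell_antimono) auto
    also have "\<dots> \<le> g i" using B[OF k(1)] i by (auto simp: W_def)
    finally show "measure M (cell (C n) i) \<le> g i" .
  qed
  have C_lim: "(\<lambda>n. C n i) \<longlonglongrightarrow> s i" if i: "i \<in> I" for i
  proof (rule tendsto_sandwich)
    show "\<forall>\<^sub>F n in sequentially. s i - 1 / Suc n \<le> C n i"
      using B[OF i] C_ge[OF i] by (intro always_eventually allI) (meson less_le_trans less_imp_le)
    show "\<forall>\<^sub>F n in sequentially. C n i \<le> s i"
      using s_upper C_W i by (intro always_eventually) auto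
    show "(\<lambda>n. s i - 1 / Suc n) \<longlonglongrightarrow> s i"
      using tendsto_diff[OF tendsto_const lim_1_over_n[THEN LIMSEQ_Suc]] by simp
  qed simp
  have s_i0: "s i0 = 1"
    using LIMSEQ_unique[OF C_lim[OF i0], of 1] C_W by (simp add: W_def)
  have s_nonneg: "\<forall>i\<in>I. 0 \<le> s i"
    using s_upper[OF \<open>?e \<in> W\<close>] W_nonneg[OF \<open>?e \<in> W\<close>] by force
  have s_lim: "(\<lambda>n. measure M (cell (B n) i)) \<longlonglongrightarrow> measure M (cell s i)"
    if "\<And>j. j \<in> I \<Longrightarrow> (\<lambda>n. B n j) \<longlonglongrightarrow> s j" "i \<in> I" for B i
    using tendsto_measure_cell[of s i0 B i] s_nonneg i0 s_i0 that by simp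
  have s_W: "s \<in> W"
  proof -
    have "measure M (cell s i) \<le> g i" if "i \<in> I - {i0}" for i
      using s_lim[OF C_lim, of i] that C_W by (intro LIMSEQ_le_const2) (auto simp: W_def)
    then show ?thesis using s_i0 s_nonneg by (simp add: W_def)
  qed

  have s_eq: "measure M (cell s i) = g i" if i: "i \<in> I - {i0}" for i
  proof (rule ccontr)
    assume "measure M (cell s i) \<noteq> g i"
    then have less: "measure M (cell s i) < g i" using s_W i by (force simp: W_def)
    let ?S = "\<lambda>n. s(i := s i + 1 / real (Suc n))"
    have "(\<lambda>n. measure M (cell (?S n) i)) \<longlonglongrightarrow> measure M (cell s i)"
    proof (rule s_lim)
      have "(\<lambda>n. s i + 1 / real (Suc n)) \<longlonglongrightarrow> s i"
        using tendsto_add[OF tendsto_const lim_1_over_n[THEN LIMSEQ_Suc]] by simp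
      then show "(\<lambda>n. ?S n j) \<longlonglongrightarrow> s j" for j by (cases "j = i") auto
    qed (use i in auto)
    then obtain n where n: "measure M (cell (?S n) i) < g i"
      using order_tendstoD(2)[OF _ less] eventually_happens'[OF sequentially_bot] by blast
    have "measure M (cell (?S n) j) \<le> g j" if j: "j \<in> I - {i0, i}" for j
    proof -
      have "measure M (cell (?S n) j) \<le> measure M (cell s j)"
        using j by (intro finite_measure_mono cell_antimono) auto
      also have "\<dots> \<le> g j" using s_W j by (auto simp: W_def)
      finally show ?thesis .
    qed
    then have "measure M (cell (?S n) j) \<le> g j" if "j \<in> I - {i0}" for j
      using that n by (cases "j = i") auto
    then have "?S n \<in> W" using i s_i0 s_nonneg unfolding W_def by (auto simp del: of_nat_Suc)
    from s_upper[OF this, of i] i have "1 / real (Suc n) \<le> 0" by simp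
    then show False by simp
  qed
  have "(\<Sum>i\<in>I - {i0}. measure M (cell s i)) = (\<Sum>i\<in>I - {i0}. g i)"
    using s_eq by (rule sum.cong[OF refl])
  then have "measure M (cell s i0) = g i0"
    using cells_total[OF s_W] finite_index i0 by (simp add: sum.remove)
  with s_eq have eq: "measure M (cell s i) = g i" if "i \<in> I" for i
    using that by (cases "i = i0") auto
  moreover have "0 < s i" if "i \<in> I" for i
    using cell_eq_empty[where b=s, OF that _ i0] eq[OF that] g s_nonneg that s_i0
    by (cases "s i = 0") auto
  ultimately show ?thesis by blast
qed

end

section \<open>Hyperplane sections of the sphere\<close>

text \<open>
  A unit vector \<open>x\<close> satisfies \<open>a \<bullet> x = c\<close> precisely if the ray through \<open>x\<close> lies on the cone
  \<open>a \<bullet> y = c * norm y\<close>. The gap \<open>a \<bullet> y - c * norm y\<close> decreases along \<open>- a\<close> if \<open>\<bar>c\<bar> < norm a\<close>: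
  the step lowers the first term by \<open>t * (norm a)\<^sup>2\<close> and changes the second by at most
  \<open>t * \<bar>c\<bar> * norm a\<close>.
\<close>

lemma cone_gap_decreases:
  fixes a y :: "'a::real_inner"
  assumes "\<bar>c\<bar> < norm a" "0 < t"
  shows "a \<bullet> (y - t *\<^sub>R a) - c * norm (y - t *\<^sub>R a) < a \<bullet> y - c * norm y"
proof -
  have "\<bar>norm y - norm (y - t *\<^sub>R a)\<bar> \<le> t * norm a"
    using norm_triangle_ineq3[of y "y - t *\<^sub>R a"] \<open>0 < t\<close> by simp
  then have "\<bar>c\<bar> * \<bar>norm y - norm (y - t *\<^sub>R a)\<bar> \<le> \<bar>c\<bar> * (t * norm a)"
    by (intro mult_left_mono) auto
  then have "c * (norm y - norm (y - t *\<^sub>R a)) \<le> \<bar>c\<bar> * (t * norm a)"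
    by (metis abs_ge_self abs_mult order_trans)
  also have "\<dots> < norm a * (t * norm a)"
    using assms by (intro mult_strict_right_mono mult_pos_pos) auto
  also have "\<dots> = t * (a \<bullet> a)" by (simp add: dot_square_norm power2_eq_square)
  finally show ?thesis by (simp add: algebra_simps inner_diff_right)
qed

text \<open>For \<open>c \<ge> 0\<close> this cone lies in the frontier of a convex set, and such frontiers are negligible.\<close>

lemma negligible_cone:
  fixes a :: "'a::euclidean_space"
  assumes "\<bar>c\<bar> < norm a"
  shows "negligible {y. a \<bullet> y = c * norm y}"
proof -
  have *: "negligible {y. a \<bullet> y = c * norm y}" if "0 \<le> c" "c < norm a" for a :: 'a and c
  proof -
    let ?C = "{y. c * norm y \<le> a \<bullet> y}"
    have "convex ?C"
    proof (rule convexI)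
      fix x y :: 'a and u v :: real
      assume xy: "x \<in> ?C" "y \<in> ?C" and uv: "0 \<le> u" "0 \<le> v"
      have "c * norm (u *\<^sub>R x + v *\<^sub>R y) \<le> c * (u * norm x + v * norm y)"
        using norm_triangle_ineq[of "u *\<^sub>R x" "v *\<^sub>R y"] uv \<open>0 \<le> c\<close>
        by (intro mult_left_mono) auto
      also have "\<dots> = u * (c * norm x) + v * (c * norm y)" by (simp add: algebra_simps)
      also have "\<dots> \<le> u * (a \<bullet> x) + v * (a \<bullet> y)"
        using xy uv by (intro add_mono mult_left_mono) auto
      finally show "u *\<^sub>R x + v *\<^sub>R y \<in> ?C" by (simp add: inner_add_right)
    qed
    then have "negligible (frontier ?C)" by (rule negligible_convex_frontier)
    moreover have "{y. a \<bullet> y = c * norm y} \<subseteq> frontier ?C"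
    proof
      fix y assume y: "y \<in> {y. a \<bullet> y = c * norm y}"
      have "y \<notin> interior ?C"
      proof
        assume "y \<in> interior ?C"
        have "((\<lambda>t. y - t *\<^sub>R a) \<longlongrightarrow> y - 0 *\<^sub>R a) (at_right 0)"
          by (intro tendsto_intros)
        then have "\<forall>\<^sub>F t in at_right 0. y - t *\<^sub>R a \<in> interior ?C"
          using \<open>y \<in> interior ?C\<close> topological_tendstoD[of _ y "at_right 0" "interior ?C"] by simp
        then have "\<forall>\<^sub>F t::real in at_right 0. False"
          using eventually_at_right_less
        proof eventually_elim
          case (elim t)
          then have "c * norm (y - t *\<^sub>R a) \<le> a \<bullet> (y - t *\<^sub>R a)"
            using interior_subset by blast
          then show ?case using cone_gap_decreases[of c a t y] elim that y by simp
        qed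
        then show False by simp
      qed
      then show "y \<in> frontier ?C" using y closure_subset[of ?C] by (auto simp: frontier_def)
    qed
    ultimately show ?thesis by (rule negligible_subset)
  qed
  show ?thesis
  proof (cases "0 \<le> c")
    case False
    have "{y. a \<bullet> y = c * norm y} = {y. (- a) \<bullet> y = (- c) * norm y}" by auto
    then show ?thesis using *[of "- c" "- a"] False assms by simp
  qed (use * assms in auto)
qed

lemma sphere_hyperplane_null:
  fixes a :: "'a::euclidean_space"
  assumes "\<bar>c\<bar> < norm a"
  shows "{x \<in> sphere 0 1. a \<bullet> x = c} \<in> null_sets surface_measure"
proof -
  let ?A = "{x \<in> sphere 0 1. a \<bullet> x = c}"
  let ?K = "{y. a \<bullet> y = c * norm y}"
  have A: "?A \<in> sets borel"
  proof -
    have "closed ({x. norm x = 1} \<inter> {x. a \<bullet> x = c})"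
      by (intro closed_Int closed_Collect_eq continuous_intros)
    then show ?thesis by (simp add: Collect_conj_eq[symmetric] borel_closed)
  qed
  have "closed ?K" by (intro closed_Collect_eq continuous_intros)
  then have "?K \<in> null_sets lborel"
    using negligible_cone[OF assms]
    by (simp add: negligible_iff_null_sets null_sets_completion_iff borel_closed)
  moreover have "{r *\<^sub>R x |r x. 0 < r \<and> r < 1 \<and> x \<in> ?A} \<subseteq> ?K" by auto
  ultimately have "emeasure lborel {r *\<^sub>R x |r x. 0 < r \<and> r < 1 \<and> x \<in> ?A} = 0"
    by (metis (no_types, lifting) emeasure_mono le_zero_eq null_setsD1 null_setsD2)
  then have "emeasure surface_measure ?A = 0"
    using A by (subst emeasure_surface_measure) auto
  moreover have "?A \<in> sets surface_measure"
    unfolding surface_measure_def using A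
    by (intro sets_completionI_sets) (auto simp: sets_restrict_space_iff)
  ultimately show ?thesis by (simp add: null_setsI)
qed

text \<open>
  A linear function with a local minimum \<open>c\<close> on the sphere has its gradient along the normal there.
  If instead \<open>norm a\<close> exceeded \<open>\<bar>c\<bar>\<close>, then leaving \<open>x0\<close> along \<open>- a\<close> and projecting back to the
  sphere would give nearby points with a smaller value.
\<close>

lemma sphere_hyperplane_touching:
  fixes a x0 :: "'a::euclidean_space"
  assumes "x0 \<in> sphere 0 1" and touch: "a \<bullet> x0 = c"
    and above: "\<forall>\<^sub>F x in at x0 within sphere 0 1. c \<le> a \<bullet> x"
  shows "norm a \<le> \<bar>c\<bar>"
proof (rule ccontr)
  assume "\<not> norm a \<le> \<bar>c\<bar>"
  then have ac: "\<bar>c\<bar> < norm a" by simp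
  from above obtain T where T: "open T" "x0 \<in> T"
    and "\<And>x. x \<in> T \<Longrightarrow> x \<noteq> x0 \<Longrightarrow> x \<in> sphere 0 1 \<Longrightarrow> c \<le> a \<bullet> x"
    unfolding eventually_at_topological by blast
  then have above': "c \<le> a \<bullet> x" if "x \<in> T" "x \<in> sphere 0 1" for x
    using that touch by (cases "x = x0") auto
  have x0: "norm x0 = 1" using assms by simp
  have "((\<lambda>t. sgn (x0 - t *\<^sub>R a)) \<longlongrightarrow> sgn (x0 - 0 *\<^sub>R a)) (at_right 0)"
    using x0 by (intro tendsto_intros) auto
  then have "((\<lambda>t. sgn (x0 - t *\<^sub>R a)) \<longlongrightarrow> x0) (at_right 0)"
    using x0 by (simp add: sgn_div_norm)
  then have "\<forall>\<^sub>F t in at_right 0. sgn (x0 - t *\<^sub>R a) \<in> T"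
    using T by (intro topological_tendstoD)
  moreover have "\<forall>\<^sub>F t in at_right 0. x0 - t *\<^sub>R a \<noteq> 0"
  proof (rule tendsto_imp_eventually_ne)
    show "((\<lambda>t. x0 - t *\<^sub>R a) \<longlongrightarrow> x0 - 0 *\<^sub>R a) (at_right 0)" by (intro tendsto_intros)
  qed (use x0 in auto)
  ultimately have "\<forall>\<^sub>F t::real in at_right 0. False"
    using eventually_at_right_less
  proof eventually_elim
    case (elim t)
    let ?y = "x0 - t *\<^sub>R a"
    have "norm ?y * c \<le> norm ?y * (a \<bullet> sgn ?y)"
      using above'[of "sgn ?y"] elim by (intro mult_left_mono) (auto simp: norm_sgn)
    also have "\<dots> = a \<bullet> ?y" using elim by (simp add: sgn_div_norm)
    finally show ?case
      using cone_gap_decreases[OF ac \<open>0 < t\<close>, of x0] touch x0 by (simp add: mult.commute)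
  qed
  then show False by simp
qed

text \<open>
  The equation \<open>s * (\<kappa> * (q \<bullet> x) - 1) = t * (\<kappa> * (p \<bullet> x) - 1)\<close> of a tie between two
  semi-hyperboloids reads \<open>a \<bullet> x = s - t\<close> for the vector \<open>a\<close> below. Since \<open>p\<close> and \<open>q\<close> are unit
  vectors, \<open>\<bar>s - t\<bar> \<le> norm (s q - t p)\<close>; the right-hand side is positive for \<open>p \<noteq> q\<close>, so the factor
  \<open>\<kappa> > 1\<close> makes the inequality strict.
\<close>

lemma norm_scaled_diff_gt:
  fixes p q :: "'a::real_inner"
  assumes "norm p = 1" "norm q = 1" "p \<noteq> q" "1 < \<kappa>" "0 < s" "0 < t"
  shows "\<bar>s - t\<bar> < norm (\<kappa> *\<^sub>R (s *\<^sub>R q - t *\<^sub>R p))"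
proof -
  have ge: "\<bar>s - t\<bar> \<le> norm (s *\<^sub>R q - t *\<^sub>R p)"
    using norm_triangle_ineq3[of "s *\<^sub>R q" "t *\<^sub>R p"] assms by simp
  have "0 < norm (s *\<^sub>R q - t *\<^sub>R p)"
  proof (rule ccontr)
    assume "\<not> 0 < norm (s *\<^sub>R q - t *\<^sub>R p)"
    then have "s *\<^sub>R q = t *\<^sub>R p" "s = t" using ge by auto
    then show False using assms by simp
  qed
  then have "norm (s *\<^sub>R q - t *\<^sub>R p) < \<kappa> * norm (s *\<^sub>R q - t *\<^sub>R p)"
    using \<open>1 < \<kappa>\<close> by simp
  with ge show ?thesis using \<open>1 < \<kappa>\<close> by simp
qed

section \<open>Semi-hyperboloids and the refractor mapping\<close>

lemma sets_surface_measure_borel: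
  assumes "A \<in> sets borel" "A \<subseteq> sphere 0 1"
  shows "A \<in> sets surface_measure"
  unfolding surface_measure_def using assms
  by (intro sets_completionI_sets) (auto simp: sets_restrict_space_iff)

lemma borel_measurable_surface_measure:
  fixes h :: "'a::euclidean_space \<Rightarrow> 'b::topological_space"
  assumes "h \<in> borel_measurable borel"
  shows "h \<in> borel_measurable surface_measure"
proof (rule measurableI)
  fix B :: "'b set" assume "B \<in> sets borel"
  with measurable_sets[OF assms this] have "h -` B \<in> sets borel" by simp
  then show "h -` B \<inter> space surface_measure \<in> sets surface_measure"
    by (intro sets_surface_measure_borel) auto
qed simp

lemma semi_hyperboloid_denominator_pos:
  fixes A B :: "'a::euclidean_space set"
  assumes "1 < \<kappa>" "0 < \<delta>" and AB: "\<And>x p. x \<in> A \<Longrightarrow> p \<in> B \<Longrightarrow> 1 / \<kappa> + \<delta> \<le> x \<bullet> p"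
    and x: "x \<in> closure A" and p: "p \<in> closure B"
  shows "0 < \<kappa> * (p \<bullet> x) - 1"
proof -
  have "1 / \<kappa> + \<delta> \<le> fst z \<bullet> snd z" if "z \<in> closure (A \<times> B)" for z
    by (rule continuous_ge_on_closure[OF _ that]) (auto intro!: continuous_intros AB)
  from this[of "(x, p)"] x p have "1 / \<kappa> + \<delta> \<le> p \<bullet> x"
    by (simp add: closure_Times inner_commute)
  then have "1 / \<kappa> < p \<bullet> x" using \<open>0 < \<delta>\<close> by linarith
  then show ?thesis using \<open>1 < \<kappa>\<close> by (simp add: divide_less_eq mult.commute)
qed

text \<open>
  After clearing denominators, the touching says that a linear function has a local minimum on the
  sphere at \<open>x\<close>, with the value \<open>t - s\<close>; \<open>norm_scaled_diff_gt\<close> excludes this for different axes.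
\<close>

lemma semi_hyperboloids_touching_eq:
  fixes p q :: "'a::euclidean_space"
  assumes "1 < \<kappa>" "norm p = 1" "norm q = 1" "0 < s" "0 < t" and x: "x \<in> sphere 0 1"
    and den: "0 < \<kappa> * (p \<bullet> x) - 1" "0 < \<kappa> * (q \<bullet> x) - 1"
    and touch: "semi_hyperboloid \<kappa> p s x = semi_hyperboloid \<kappa> q t x"
    and below: "\<forall>\<^sub>F y in at x within sphere 0 1. 0 < \<kappa> * (p \<bullet> y) - 1 \<and> 0 < \<kappa> * (q \<bullet> y) - 1 \<and>
      semi_hyperboloid \<kappa> p s y \<le> semi_hyperboloid \<kappa> q t y"
  shows "p = q"
proof (rule ccontr)
  assume "p \<noteq> q"
  let ?a = "\<kappa> *\<^sub>R (t *\<^sub>R p - s *\<^sub>R q)"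
  have "norm ?a \<le> \<bar>t - s\<bar>"
  proof (rule sphere_hyperplane_touching[OF x])
    show "?a \<bullet> x = t - s"
      using touch den by (simp add: semi_hyperboloid_def field_simps inner_diff_left)
    show "\<forall>\<^sub>F y in at x within sphere 0 1. t - s \<le> ?a \<bullet> y"
      using below
    proof eventually_elim
      case (elim y)
      moreover have "s * v \<le> t * u" if "0 < u" "0 < v" "s / u \<le> t / v" for u v :: real
        using that by (simp add: field_simps)
      ultimately have "s * (\<kappa> * (q \<bullet> y) - 1) \<le> t * (\<kappa> * (p \<bullet> y) - 1)"
        unfolding semi_hyperboloid_def by blast
      then show ?case by (simp add: algebra_simps inner_diff_left)
    qed
  qed
  with norm_scaled_diff_gt[of q p \<kappa> t s] assms \<open>p \<noteq> q\<close> show False by simp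
qed

lemma AE_semi_hyperboloid_no_tie:
  fixes p q :: "'a::euclidean_space"
  assumes "1 < \<kappa>" "norm p = 1" "norm q = 1" "p \<noteq> q" "0 < s" "0 < t"
  shows "AE x in surface_measure. 0 < \<kappa> * (p \<bullet> x) - 1 \<longrightarrow> 0 < \<kappa> * (q \<bullet> x) - 1 \<longrightarrow>
    semi_hyperboloid \<kappa> p s x \<noteq> semi_hyperboloid \<kappa> q t x"
proof -
  let ?a = "\<kappa> *\<^sub>R (t *\<^sub>R p - s *\<^sub>R q)"
  have "{x \<in> sphere 0 1. ?a \<bullet> x = t - s} \<in> null_sets surface_measure"
    using assms by (intro sphere_hyperplane_null norm_scaled_diff_gt) auto
  from AE_not_in[OF this] AE_space show ?thesis
    by eventually_elim (auto simp: semi_hyperboloid_def field_simps inner_diff_left)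
qed

lemma continuous_on_MAX:
  fixes f :: "'i \<Rightarrow> 'a::topological_space \<Rightarrow> real"
  assumes "finite I" "I \<noteq> {}" "\<And>i. i \<in> I \<Longrightarrow> continuous_on S (f i)"
  shows "continuous_on S (\<lambda>x. MAX i\<in>I. f i x)"
  using assms
proof (induction rule: finite_ne_induct)
  case (insert i I)
  then show ?case by (auto intro!: continuous_on_max)
qed simp

lemma far_field_refractor_MAX:
  fixes m :: "'i \<Rightarrow> 'a::euclidean_space"
  assumes I: "finite I" "I \<noteq> {}" and m: "\<And>i. i \<in> I \<Longrightarrow> m i \<in> closure \<Omega>s"
    and b: "\<And>i. i \<in> I \<Longrightarrow> 0 < b i"
    and den: "\<And>i x. i \<in> I \<Longrightarrow> x \<in> closure \<Omega> \<Longrightarrow> 0 < \<kappa> * (m i \<bullet> x) - 1"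
  shows "far_field_refractor \<kappa> \<Omega> \<Omega>s (\<lambda>x. MAX i\<in>I. semi_hyperboloid \<kappa> (m i) (b i) x)"
proof -
  let ?H = "\<lambda>i. semi_hyperboloid \<kappa> (m i) (b i)"
  have attained: "\<exists>i\<in>I. (MAX i\<in>I. ?H i x) = ?H i x" for x
  proof -
    have "(MAX i\<in>I. ?H i x) \<in> (\<lambda>i. ?H i x) ` I" using I by (intro Max_in) auto
    then show ?thesis by auto
  qed
  show ?thesis
    unfolding far_field_refractor_def
  proof (intro conjI ballI)
    have "continuous_on (closure \<Omega>) (?H i)" if "i \<in> I" for i
      unfolding semi_hyperboloid_def using den[OF that] by (intro continuous_intros) force
    then show "continuous_on (closure \<Omega>) (\<lambda>x. MAX i\<in>I. ?H i x)"
      using I by (intro continuous_on_MAX)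
  next
    fix x assume x: "x \<in> closure \<Omega>"
    obtain i where i: "i \<in> I" "(MAX i\<in>I. ?H i x) = ?H i x" using attained by blast
    show "0 < (MAX i\<in>I. ?H i x)"
      using i b[OF i(1)] den[OF i(1) x] by (simp add: semi_hyperboloid_def)
    have "supports_at \<kappa> \<Omega> (\<lambda>x. MAX i\<in>I. ?H i x) (m i) (b i) x"
      using i I by (auto simp: supports_at_def intro!: Max_ge)
    then show "\<exists>p\<in>closure \<Omega>s. \<exists>c>0. supports_at \<kappa> \<Omega> (\<lambda>x. MAX i\<in>I. ?H i x) p c x"
      using i b m by blast
  qed
qed

text \<open>
  At a point \<open>x\<close> of the open set \<open>\<Omega>\<close> where \<open>i\<close> is the strict maximiser, \<open>\<rho>\<close> coincides near \<open>x\<close> with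
  the semi-hyperboloid of \<open>i\<close>. A semi-hyperboloid supporting \<open>\<rho>\<close> at \<open>x\<close> therefore touches that one
  from below, and has the same axis. The admissible axes range over all of \<open>closure \<Omega>s\<close>, so this
  also excludes every direction outside the given family.
\<close>

lemma refractor_mapping_MAX:
  fixes m :: "'i \<Rightarrow> 'a::euclidean_space"
  assumes I: "finite I" "i \<in> I" and "1 < \<kappa>" and m: "\<And>j. j \<in> I \<Longrightarrow> m j \<in> closure \<Omega>s"
    and \<Omega>: "openin (top_of_set (sphere 0 1)) \<Omega>" and \<Omega>s: "\<Omega>s \<subseteq> sphere 0 1"
    and b: "0 < b i"
    and den: "\<And>p x. p \<in> closure \<Omega>s \<Longrightarrow> x \<in> closure \<Omega> \<Longrightarrow> 0 < \<kappa> * (p \<bullet> x) - 1"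
    and x: "x \<in> \<Omega>"
    and strict: "\<And>j. j \<in> I - {i} \<Longrightarrow>
      semi_hyperboloid \<kappa> (m j) (b j) x < semi_hyperboloid \<kappa> (m i) (b i) x"
  shows "refractor_mapping \<kappa> \<Omega> \<Omega>s (\<lambda>x. MAX i\<in>I. semi_hyperboloid \<kappa> (m i) (b i) x) x = {m i}"
proof -
  let ?H = "\<lambda>i. semi_hyperboloid \<kappa> (m i) (b i)"
  let ?\<rho> = "\<lambda>x. MAX i\<in>I. ?H i x"
  have \<rho>_eq: "?\<rho> y = ?H i y" if "\<forall>j\<in>I - {i}. ?H j y < ?H i y" for y
    using I that by (intro Max_eqI) (auto intro: less_imp_le)
  have unit: "norm p = 1" if "p \<in> closure \<Omega>s" for p
    using that closure_minimal[OF \<Omega>s] by auto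
  from \<Omega> obtain T where T: "open T" "\<Omega> = sphere 0 1 \<inter> T" by (auto simp: openin_open)
  have x': "x \<in> closure \<Omega>" using x closure_subset by blast

  have near: "\<forall>\<^sub>F y in at x within sphere 0 1. y \<in> \<Omega> \<and> (\<forall>j\<in>I - {i}. ?H j y < ?H i y)"
  proof (rule eventually_conj)
    show "\<forall>\<^sub>F y in at x within sphere 0 1. y \<in> \<Omega>"
      using T x by (auto simp: eventually_at_topological)
    have lim: "(?H j \<longlongrightarrow> ?H j x) (at x within sphere 0 1)" if "j \<in> I" for j
      unfolding semi_hyperboloid_def using den[OF m[OF that] x'] by (intro tendsto_intros) auto
    have "\<forall>\<^sub>F y in at x within sphere 0 1. ?H j y < ?H i y" if "j \<in> I - {i}" for j
      using order_tendstoD(1)[OF tendsto_diff[OF lim[of i] lim[of j]], of 0] that strict[OF that] I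
      by simp
    then show "\<forall>\<^sub>F y in at x within sphere 0 1. \<forall>j\<in>I - {i}. ?H j y < ?H i y"
      using I by (intro eventually_ball_finite) auto
  qed
  have "p = m i" if p: "p \<in> closure \<Omega>s" and s: "0 < s" and supp: "supports_at \<kappa> \<Omega> ?\<rho> p s x" for p s
  proof (rule semi_hyperboloids_touching_eq[where s = s and t = "b i" and x = x and \<kappa> = \<kappa>])
    show "semi_hyperboloid \<kappa> p s x = ?H i x"
      using supp \<rho>_eq[of x] strict by (simp add: supports_at_def)
    show "\<forall>\<^sub>F y in at x within sphere 0 1. 0 < \<kappa> * (p \<bullet> y) - 1 \<and> 0 < \<kappa> * (m i \<bullet> y) - 1 \<and>
      semi_hyperboloid \<kappa> p s y \<le> ?H i y"
      using near
    proof eventually_elim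
      case (elim y)
      then have y: "y \<in> closure \<Omega>" using closure_subset by blast
      then have "semi_hyperboloid \<kappa> p s y \<le> ?\<rho> y" using supp by (simp add: supports_at_def)
      then show ?case using elim \<rho>_eq[of y] y p m I den by simp
    qed
  qed (use assms p s unit x' T in auto)
  moreover have "supports_at \<kappa> \<Omega> ?\<rho> (m i) (b i) x"
    using I \<rho>_eq[of x] strict by (auto simp: supports_at_def intro!: Max_ge)
  ultimately show ?thesis unfolding refractor_mapping_def using I b m by blast
qed

section \<open>Refractors with prescribed finitely supported intensity\<close>

theorem theorem7p5:
  fixes \<kappa> \<delta> :: real and \<Omega> \<Omega>s :: "'a::euclidean_space set"
    and N :: nat and m :: "nat \<Rightarrow> 'a" and g :: "nat \<Rightarrow> real" and f :: "'a \<Rightarrow> real"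
  assumes "DIM('a) \<ge> 2" and "\<kappa> > 1" and "\<delta> > 0"
    and "spherical_domain \<Omega>" and "spherical_domain \<Omega>s"
    and "top_of_set (sphere 0 1) frontier_of \<Omega> \<in> null_sets surface_measure"
    and "\<And>x p. x \<in> \<Omega> \<Longrightarrow> p \<in> \<Omega>s \<Longrightarrow> x \<bullet> p \<ge> 1 / \<kappa> + \<delta>"
    and "N \<ge> 1" and "\<And>i. i \<in> {1..N} \<Longrightarrow> m i \<in> closure \<Omega>s" and "inj_on m {1..N}"
    and "\<And>i. i \<in> {1..N} \<Longrightarrow> g i > 0"
    and "set_integrable surface_measure \<Omega> f"
    and "AE x in surface_measure. x \<in> \<Omega> \<longrightarrow> f x \<ge> 0"
    and "\<And>x i. x \<in> \<Omega> \<Longrightarrow> i \<in> {1..N} \<Longrightarrow> x \<bullet> m i \<ge> 1 / \<kappa> + \<delta>"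
    and "(LINT x:closure \<Omega>|surface_measure. f x) = (\<Sum>i=1..N. g i)"
  shows "\<exists>b :: nat \<Rightarrow> real. (\<forall>i\<in>{1..N}. b i > 0) \<and>
    (let \<rho> = (\<lambda>x. MAX i\<in>{1..N}. semi_hyperboloid \<kappa> (m i) (b i) x) in
       weak_solution \<kappa> \<Omega> \<Omega>s f (dirac_sum (closure \<Omega>s) {1..N} g m) \<rho> \<and>
       (\<forall>i\<in>{1..N}. refractor_measure \<kappa> \<Omega> \<Omega>s \<rho> f {m i} = ennreal (g i)))"
proof -
  note \<kappa> = \<open>\<kappa> > 1\<close>
  define I where "I = {1..N}"
  note m = assms(9)[folded I_def] and inj = assms(10)[folded I_def] and g = assms(11)[folded I_def]
    and total = assms(15)[folded I_def]
  let ?C = "closure \<Omega>" and ?S = "surface_measure :: 'a measure"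
  have I: "finite I" "I \<noteq> {}" using \<open>N \<ge> 1\<close> by (auto simp: I_def)
  have open_\<Omega>: "openin (top_of_set (sphere 0 1)) \<Omega>" and sub: "\<Omega> \<subseteq> sphere 0 1" "\<Omega>s \<subseteq> sphere 0 1"
    using assms(4,5) openin_imp_subset by (auto simp: spherical_domain_def)
  have C: "?C \<subseteq> sphere 0 1" "\<Omega> \<subseteq> ?C"
    by (rule closure_minimal[OF sub(1)], simp, rule closure_subset)
  have unit: "norm p = 1" if "p \<in> closure \<Omega>s" for p
    using that closure_minimal[OF sub(2)] by auto
  have C_sets: "?C \<in> sets ?S" using C by (intro sets_surface_measure_borel) auto
  then have C_int: "?C \<inter> space ?S \<in> sets ?S" by blast
  have den: "0 < \<kappa> * (p \<bullet> x) - 1" if "p \<in> closure \<Omega>s" "x \<in> ?C" for p x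
    by (rule semi_hyperboloid_denominator_pos[OF \<kappa> \<open>\<delta> > 0\<close> assms(7) that(2,1)])
  have "top_of_set (sphere 0 1) frontier_of \<Omega> = ?C - \<Omega>"
  proof -
    have "top_of_set (sphere 0 1) interior_of \<Omega> = \<Omega>" using open_\<Omega> by (rule interior_of_openin)
    moreover have "top_of_set (sphere 0 1) closure_of \<Omega> = ?C"
      using C sub by (simp add: closure_of_subtopology Int_absorb1)
    ultimately show ?thesis by (simp add: frontier_of_def)
  qed
  then have frontier_null: "AE x in ?S. x \<in> ?C \<longrightarrow> x \<in> \<Omega>"
    using AE_not_in[OF assms(6)] by auto

  define R where "R = restrict_space ?S ?C"
  have space_R: "space R = ?C" using C by (auto simp: R_def space_restrict_space)
  have sum_pos: "0 < (\<Sum>i\<in>I. g i)" using I g by (intro sum_pos) auto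
  have int_R: "(LINT x|R. f x) = (\<Sum>i\<in>I. g i)"
    using total
    by (simp add: R_def integral_restrict_space[OF C_int] set_lebesgue_integral_def)
  \<comment> \<open>A Bochner integral that is not zero belongs to an integrable function.\<close>
  then have f_int: "integrable R f"
    using not_integrable_integral_eq[of R f] sum_pos by auto
  then have f_meas [measurable]: "f \<in> borel_measurable R" by (rule borel_measurable_integrable)
  have "AE x in ?S. x \<in> ?C \<longrightarrow> 0 \<le> f x"
    using assms(13) frontier_null by eventually_elim blast
  then have f_nonneg: "AE x in R. 0 \<le> f x"
    unfolding R_def AE_restrict_space_iff[OF C_int] .

  \<comment> \<open>The measure whose cells are balanced is the emitted intensity on \<open>closure \<Omega>\<close>.\<close>
  define \<nu> where "\<nu> = density R (\<lambda>x. ennreal (f x))"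
  have space_\<nu>: "space \<nu> = ?C" by (simp add: \<nu>_def space_R)
  have sets_\<nu>: "sets \<nu> = sets R" by (simp add: \<nu>_def)
  have emeasure_\<nu>: "emeasure \<nu> A = (\<integral>\<^sup>+x\<in>A. ennreal (f x) \<partial>?S)" if A: "A \<in> sets R" for A
  proof -
    have "A \<subseteq> ?C" using sets.sets_into_space[OF A] by (simp add: space_R)
    have "emeasure \<nu> A = (\<integral>\<^sup>+x. ennreal (f x) * indicator A x \<partial>R)"
      using A by (simp add: \<nu>_def emeasure_density)
    also have "\<dots> = (\<integral>\<^sup>+x. ennreal (f x) * indicator A x * indicator ?C x \<partial>?S)"
      unfolding R_def by (rule nn_integral_restrict_space[OF C_int])
    also have "\<dots> = (\<integral>\<^sup>+x\<in>A. ennreal (f x) \<partial>?S)"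
      using \<open>A \<subseteq> ?C\<close> by (intro nn_integral_cong) (auto simp: indicator_def)
    finally show ?thesis .
  qed
  have emeasure_total: "emeasure \<nu> (space \<nu>) = ennreal (\<Sum>i\<in>I. g i)"
  proof -
    have "emeasure \<nu> (space R) = (\<integral>\<^sup>+x. ennreal (f x) * indicator (space R) x \<partial>R)"
      unfolding \<nu>_def by (intro emeasure_density) auto
    also have "\<dots> = (\<integral>\<^sup>+x. ennreal (f x) \<partial>R)"
      by (intro nn_integral_cong) simp
    also have "\<dots> = ennreal (\<Sum>i\<in>I. g i)"
      using nn_integral_eq_integral[OF f_int f_nonneg] int_R by simp
    finally show ?thesis by (simp add: \<nu>_def)
  qed

  let ?h = "\<lambda>i. semi_hyperboloid \<kappa> (m i) 1"
  have H_eq: "b * ?h i x = semi_hyperboloid \<kappa> (m i) b x" for b i x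
    by (simp add: semi_hyperboloid_def)
  have no_tie: "AE x in ?S. x \<in> ?C \<longrightarrow>
      semi_hyperboloid \<kappa> (m i) s x \<noteq> semi_hyperboloid \<kappa> (m j) t x"
    if "i \<in> I" "j \<in> I" "i \<noteq> j" "0 < s" "0 < t" for i j s t
  proof -
    have "m i \<noteq> m j" using inj that by (auto dest: inj_onD)
    from AE_semi_hyperboloid_no_tie[OF \<kappa> unit[OF m[OF that(1)]] unit[OF m[OF that(2)]] this that(4,5)]
    show ?thesis
      by eventually_elim (use den m that in blast)
  qed
  interpret weighted_cells \<nu> I ?h
  proof (intro weighted_cells.intro weighted_cells_axioms.intro finite_measureI)
    show "emeasure \<nu> (space \<nu>) \<noteq> \<infinity>" by (simp add: emeasure_total)
    show "finite I" by (rule I)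
    show "?h i \<in> borel_measurable \<nu>" for i
    proof -
      have "?h i \<in> borel_measurable ?S"
        unfolding semi_hyperboloid_def by (intro borel_measurable_surface_measure) measurable
      then have "?h i \<in> borel_measurable R"
        unfolding R_def by (rule measurable_restrict_space1)
      then show ?thesis by (simp add: \<nu>_def)
    qed
    show "0 < ?h i x" if "i \<in> I" "x \<in> space \<nu>" for i x
      using den[OF m[OF that(1)], of x] that by (simp add: semi_hyperboloid_def space_\<nu>)
    show "AE x in \<nu>. s * ?h i x \<noteq> t * ?h j x"
      if "i \<in> I" "j \<in> I" "i \<noteq> j" "0 < s" "0 < t" for i j s t
    proof -
      have "AE x in R. s * ?h i x \<noteq> t * ?h j x"
        using no_tie[OF that] unfolding R_def AE_restrict_space_iff[OF C_int] H_eq .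
      then show ?thesis unfolding \<nu>_def by (subst AE_density) (auto elim: eventually_mono)
    qed
  qed
  have "measure \<nu> (space \<nu>) = (\<Sum>i\<in>I. g i)"
    using emeasure_total sum_pos by (simp add: measure_def)
  then obtain b where b: "\<And>i. i \<in> I \<Longrightarrow> 0 < b i"
    and cell_b: "\<And>i. i \<in> I \<Longrightarrow> measure \<nu> (cell b i) = g i"
    using exists_weights_with_cell_measures[OF I(2), of g] g by blast

  let ?H = "\<lambda>i. semi_hyperboloid \<kappa> (m i) (b i)"
  let ?\<rho> = "\<lambda>x. MAX i\<in>I. ?H i x"
  let ?P = "refractor_preimage \<kappa> \<Omega> \<Omega>s ?\<rho>"
  let ?J = "\<lambda>F. {i \<in> I. m i \<in> F}"
  have cell_eq: "cell b i = {x \<in> ?C. \<forall>j\<in>I. ?H j x \<le> ?H i x}" for i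
    unfolding cell_def space_\<nu> H_eq ..

  \<comment> \<open>For the measurability of preimages, the exceptional set has to be null for the surface measure
    itself and not merely for \<open>\<nu>\<close>, which ignores the zeros of \<open>f\<close>.\<close>
  have "AE x in ?S. \<forall>i\<in>I. \<forall>j\<in>I - {i}. x \<in> ?C \<longrightarrow> ?H i x \<noteq> ?H j x"
    using b no_tie I by (intro AE_finite_allI) auto
  with frontier_null
  have preimage_AE: "AE x in ?S. x \<in> (\<Union>i\<in>?J F. cell b i) \<longleftrightarrow> x \<in> ?P F" for F
  proof eventually_elim
    case (elim x)
    show ?case
    proof (cases "x \<in> ?C")
      case True
      then obtain i where i: "i \<in> I" "x \<in> cell b i"
        using UN_cell[OF I(2), of b] by (auto simp: space_\<nu>)
      have strict: "?H j x < ?H i x" if "j \<in> I - {i}" for j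
        using elim i that by (force simp: cell_eq less_le)
      have "refractor_mapping \<kappa> \<Omega> \<Omega>s ?\<rho> x = {m i}"
        by (rule refractor_mapping_MAX) (use I i \<kappa> m open_\<Omega> sub b den elim True strict in auto)
      then have "x \<in> ?P F \<longleftrightarrow> m i \<in> F"
        using True by (simp add: refractor_preimage_def)
      moreover have "k = i" if "k \<in> I" "x \<in> cell b k" for k
        using strict[of k] that i by (force simp: cell_eq)
      ultimately show ?thesis using i by blast
    next
      case False
      then show ?thesis by (auto simp: refractor_preimage_def cell_eq)
    qed
  qed

  have cells_R: "(\<Union>i\<in>?J F. cell b i) \<in> sets R" for F
    using sets_cell[of _ b] by (auto simp: sets_\<nu>)
  have preimage_sets: "?P F \<in> sets ?S" for F
  proof -
    have "(\<Union>i\<in>?J F. cell b i) \<in> sets ?S"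
      using cells_R[of F] by (simp add: R_def sets_restrict_space_iff[OF C_int])
    with preimage_AE[of F] show ?thesis
      unfolding surface_measure_def
      by (rule completion.in_sets_AE)
        (use C in \<open>auto simp: refractor_preimage_def space_restrict_space space_scale_measure\<close>)
  qed
  have refractor_measure_eq: "refractor_measure \<kappa> \<Omega> \<Omega>s ?\<rho> f F =
    (\<Sum>i\<in>I. ennreal (g i) * indicator F (m i))" for F
  proof -
    have "refractor_measure \<kappa> \<Omega> \<Omega>s ?\<rho> f F = (\<integral>\<^sup>+x\<in>(\<Union>i\<in>?J F. cell b i). ennreal (f x) \<partial>?S)"
      unfolding refractor_measure_def
    proof (rule nn_integral_cong_AE)
      show "AE x in ?S. ennreal (f x) * indicator (?P F) x =
          ennreal (f x) * indicator (\<Union>i\<in>?J F. cell b i) x"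
        using preimage_AE[of F] by eventually_elim (simp add: indicator_def)
    qed
    also have "\<dots> = ennreal (measure \<nu> (\<Union>i\<in>?J F. cell b i))"
      using emeasure_\<nu>[OF cells_R] by (simp add: emeasure_eq_measure)
    also have "measure \<nu> (\<Union>i\<in>?J F. cell b i) = (\<Sum>i\<in>?J F. g i)"
    proof -
      obtain k where k: "k \<in> I" using I by blast
      have "\<forall>i\<in>I. 0 \<le> b i" using b by (auto intro: less_imp_le)
      then have "measure \<nu> (\<Union>i\<in>?J F. cell b i) = (\<Sum>i\<in>?J F. measure \<nu> (cell b i))"
        using measure_UN_cell[of b k "?J F"] k b by blast
      also have "\<dots> = (\<Sum>i\<in>?J F. g i)" using cell_b by (intro sum.cong) auto
      finally show ?thesis .
    qed
    also have "ennreal \<dots> = (\<Sum>i\<in>?J F. ennreal (g i))"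
      using g by (intro sum_ennreal[symmetric]) (auto intro: less_imp_le)
    also have "\<dots> = (\<Sum>i\<in>I. ennreal (g i) * indicator F (m i))"
      by (intro sum.mono_neutral_cong_left) (auto simp: indicator_def I)
    finally show ?thesis .
  qed

  have "far_field_refractor \<kappa> \<Omega> \<Omega>s ?\<rho>"
    using I m b den by (intro far_field_refractor_MAX) auto
  then have weak: "weak_solution \<kappa> \<Omega> \<Omega>s f (dirac_sum (closure \<Omega>s) I g m) ?\<rho>"
    using preimage_sets by (simp add: weak_solution_def refractor_measure_eq emeasure_dirac_sum)
  have "refractor_measure \<kappa> \<Omega> \<Omega>s ?\<rho> f {m i} = ennreal (g i)" if i: "i \<in> I" for i
  proof -
    have "(\<Sum>j\<in>I. ennreal (g j) * indicator {m i} (m j)) = (\<Sum>j\<in>{i}. ennreal (g j))"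
      using i inj by (intro sum.mono_neutral_cong_right) (auto simp: indicator_def I dest: inj_onD)
    then show ?thesis by (simp add: refractor_measure_eq)
  qed
  with b weak show ?thesis unfolding Let_def I_def[symmetric] by blast
qed

end
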